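(* For every positive integer $k$, the graph $G_k$ is vertex-pancyclic.
   Context: Graphs are finite and simple. An $m$-cycle is a cycle of length $m$ (as a subgraph). A graph $G$ of order $n\ge 3$ is vertex-pancyclic if every vertex of $G$ lies in an $m$-cycle of $G$ for every $m\in\{3,\ldots,n\}$. The graph $G_k$: let $Q=\mathbb{F}_2^3$, with elements written as binary triples and addition coordinatewise modulo $2$. Put $P_0=\{100,010\}$, $P_1=\{001,110,101\}$, $P_2=\{011,111\}$; these form a partition of $Q\setminus\{000\}$. For a positive integer $k$, the vertex set of $G_k$ is $Q\times\{0,1,2\}\times\{1,\ldots,k\}$, where the vertex $(x,i,r)$ is written $x_i^{(r)}$; so $G_k$ has order $24k$. The edges are: (i) internal edges: for every $x\in Q$ and $r\in\{1,\ldots,k\}$, the vertices $x_0^{(r)},x_1^{(r)},x_2^{(r)}$ are pairwise adjacent; (ii) external edges: if $x,y\in Q$ are distinct, $r,s\in\{1,\ldots,k\}$, $i\in\{0,1,2\}$ and $x+y\in P_i$, then $x_i^{(r)}$ and $y_i^{(s)}$ are adjacent. There are no other edges. *)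

theory Defs
  imports
    "Graph_Theory.Graph_Theory"
    "HOL-Library.Z2"
    "HOL-Library.Product_Plus"
begin

text \<open>
  Finite simple graphs are the digraphs satisfying the locale predicate \<^term>\<open>graph\<close>: finite,
  without loops or parallel arcs, and with a symmetric arc relation, so that an edge is a pair of
  opposite arcs. The constant \<^term>\<open>pre_digraph.cycle\<close> imposes no minimal length (a pair of
  opposite arcs counts as a cycle); this is harmless below, where \<open>m \<ge> 3\<close>. Every vertex
  of a cycle is the tail of exactly one of its arcs.
\<close>

definition vertex_pancyclic :: "('a, 'b) pre_digraph \<Rightarrow> bool" where
  "vertex_pancyclic G \<longleftrightarrow>
     graph G \<and> 3 \<le> card (verts G) \<and>
     (\<forall>v \<in> verts G. \<forall>m \<in> {3..card (verts G)}.
        \<exists>p. pre_digraph.cycle G p \<and> length p = m \<and> v \<in> tail G ` set p)"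

type_synonym Q = "bit \<times> bit \<times> bit"

definition P_class :: "nat \<Rightarrow> Q set" where
  "P_class i = (if i = 0 then {(1,0,0), (0,1,0)}
                else if i = 1 then {(0,0,1), (1,1,0), (1,0,1)}
                else if i = 2 then {(0,1,1), (1,1,1)}
                else {})"

text \<open>The triple \<open>(x, i, r)\<close> encodes the vertex \<open>x\<^sub>i\<close> of the \<open>r\<close>-th copy.\<close>

type_synonym vertex = "Q \<times> nat \<times> nat"

definition G_verts :: "nat \<Rightarrow> vertex set" where
  "G_verts k = UNIV \<times> {0,1,2} \<times> {1..k}"

fun internal_adj :: "vertex \<Rightarrow> vertex \<Rightarrow> bool" where
  "internal_adj (x, i, r) (y, j, s) \<longleftrightarrow> x = y \<and> r = s \<and> i \<noteq> j"

fun external_adj :: "vertex \<Rightarrow> vertex \<Rightarrow> bool" where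
  "external_adj (x, i, r) (y, j, s) \<longleftrightarrow> x \<noteq> y \<and> i = j \<and> x + y \<in> P_class i"

definition G_graph :: "nat \<Rightarrow> vertex pair_pre_digraph" where
  "G_graph k =
     \<lparr> pverts = G_verts k,
       parcs = {(u, v). u \<in> G_verts k \<and> v \<in> G_verts k \<and>
                        (internal_adj u v \<or> external_adj u v)} \<rparr>"

lemma UNIV_bit: "(UNIV :: bit set) = {0, 1}"
  using bit.exhaust by auto

lemma UNIV_Q: "(UNIV :: Q set) = {0, 1} \<times> {0, 1} \<times> {0, 1}"
  by (simp only: UNIV_bit [symmetric] UNIV_Times_UNIV)

lemma finite_Q: "finite (UNIV :: Q set)"
  unfolding UNIV_Q by (intro finite_cartesian_product finite.intros)

lemma card_Q: "card (UNIV :: Q set) = 8"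
proof -
  have c: "card {0, 1 :: bit} = 2" by simp
  show ?thesis unfolding UNIV_Q card_cartesian_product c by simp
qed

lemma P_class_partition:
  "P_class 0 \<union> P_class 1 \<union> P_class 2 = UNIV - {(0,0,0)}"
  "P_class 0 \<inter> P_class 1 = {}" "P_class 0 \<inter> P_class 2 = {}" "P_class 1 \<inter> P_class 2 = {}"
proof -
  show "P_class 0 \<union> P_class 1 \<union> P_class 2 = UNIV - {(0,0,0)}"
  proof (intro set_eqI)
    fix q :: Q
    obtain a b c where q: "q = (a, b, c)" by (cases q)
    show "q \<in> P_class 0 \<union> P_class 1 \<union> P_class 2 \<longleftrightarrow> q \<in> UNIV - {(0,0,0)}"
      unfolding q by (cases a; cases b; cases c) (simp_all add: P_class_def)
  qed
qed (simp_all add: P_class_def)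

lemma card_G_verts: "card (G_verts k) = 24 * k"
  unfolding G_verts_def card_cartesian_product card_Q by simp

lemma internal_adj_irrefl: "\<not> internal_adj u u"
  by (cases u) simp

lemma external_adj_irrefl: "\<not> external_adj u u"
  by (cases u) simp

lemma internal_adj_sym: "internal_adj u v \<Longrightarrow> internal_adj v u"
  by (cases u; cases v) simp

lemma external_adj_sym: "external_adj u v \<Longrightarrow> external_adj v u"
proof -
  obtain x i r y j s where uv: "u = (x, i, r)" "v = (y, j, s)" by (cases u, cases v)
  assume "external_adj u v"
  then have *: "x \<noteq> y" "i = j" "x + y \<in> P_class i" unfolding uv external_adj.simps by iprover+
  have "y + x \<in> P_class j" using *(3) unfolding *(2) by (subst add.commute)
  then show "external_adj v u" unfolding uv external_adj.simps using * by iprover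
qed

lemma pair_graph_G_graph: "pair_graph (G_graph k)"
proof -
  have fin: "finite (G_verts k)"
    unfolding G_verts_def by (intro finite_cartesian_product finite_Q) simp_all
  have sub: "parcs (G_graph k) \<subseteq> G_verts k \<times> G_verts k"
    unfolding G_graph_def pair_pre_digraph.simps by blast
  show ?thesis
  proof (unfold_locales, goal_cases)
    case (1 e)
    then show ?case using sub unfolding G_graph_def pair_pre_digraph.simps by force
  next
    case (2 e)
    then show ?case using sub unfolding G_graph_def pair_pre_digraph.simps by force
  next
    case 3
    then show ?case using fin unfolding G_graph_def pair_pre_digraph.simps .
  next
    case 4
    then show ?case using finite_subset [OF sub] fin by blast
  next
    case (5 e)
    then show ?case
      unfolding G_graph_def pair_pre_digraph.simps
      using internal_adj_irrefl external_adj_irrefl by (cases e) auto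
  next
    case 6
    then show ?case
      unfolding symmetric_def with_proj_simps G_graph_def pair_pre_digraph.simps
      by (rule symI) (use internal_adj_sym external_adj_sym in blast)
  qed
qed

end

theory Submission
  imports Defs
begin

text \<open>
  Call a pair \<open>(x, r)\<close> of a point of \<open>Q\<close> and a copy a cell; its three vertices form an internal
  triangle. Colour an external edge by its layer. A closed sequence of \<open>t\<close> distinct cells whose
  consecutive edges have different colours lifts to a cycle of the graph: every cell is entered in
  one layer and left in another one, and the internal edge between the two may be replaced by the
  path through the third vertex of the triangle. These detours are independent of each other, so one
  such sequence yields cycles of all lengths from \<open>2 t\<close> to \<open>3 t\<close> (\<open>cycle_thread\<close>).

  Within one copy there are such sequences with \<open>3\<close>, \<open>5\<close> and \<open>8\<close> cells, which gives the lengths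
  \<open>6..9\<close>, \<open>10..15\<close> and \<open>16..24\<close>. All three can be chosen to contain the same edge, from \<open>010\<close> to
  \<open>000\<close> in layer \<open>0\<close>. Whether two points are joined in a layer does not depend on their copies, so
  sequences cut open at that edge can be concatenated across copies and still close up
  (\<open>cyclic_tour\<close>). One sequence with \<open>3\<close>, \<open>5\<close> or \<open>8\<close> cells followed by \<open>j\<close> sequences with \<open>8\<close> cells
  in other copies reaches every length from \<open>6\<close> to \<open>24 k\<close> (\<open>word_and_copies\<close>).

  Each sequence uses all three layers. Translating \<open>Q\<close> and choosing the first copy therefore moves
  a cycle of each of these lengths through any given vertex (\<open>long_cycles\<close>). The lengths \<open>3\<close>, \<open>4\<close>
  and \<open>5\<close>, which are too short for three cells, are realised by explicit cycles within one copy
  (\<open>short_cycles\<close>).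
\<close>

section \<open>Cycles as lists of vertices\<close>

abbreviation adj :: "nat \<Rightarrow> vertex \<Rightarrow> vertex \<Rightarrow> bool" where
  "adj k u v \<equiv> (u, v) \<in> parcs (G_graph k)"

abbreviation on_cycle :: "nat \<Rightarrow> nat \<Rightarrow> vertex \<Rightarrow> bool" where
  "on_cycle k m v \<equiv>
     \<exists>p. pre_digraph.cycle (with_proj (G_graph k)) p \<and> length p = m \<and>
         v \<in> tail (with_proj (G_graph k)) ` set p"

definition cyclic_list :: "('a \<Rightarrow> 'a \<Rightarrow> bool) \<Rightarrow> 'a list \<Rightarrow> bool" where
  "cyclic_list R vs \<longleftrightarrow> vs \<noteq> [] \<and> successively R vs \<and> R (last vs) (hd vs)"

lemma adj_iff:
  "adj k (x, i, r) (y, j, s) \<longleftrightarrow>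
     i \<in> {0,1,2} \<and> j \<in> {0,1,2} \<and> r \<in> {1..k} \<and> s \<in> {1..k} \<and>
     (x = y \<and> r = s \<and> i \<noteq> j \<or> i = j \<and> x \<noteq> y \<and> x + y \<in> P_class i)"
  by (auto simp: G_graph_def G_verts_def)

text \<open>
  Pairing each vertex of a list with its successor gives the arc list of the walk along it; the
  vertex \<open>w\<close> after the last one is \<open>u\<close> itself when the walk is closed.
\<close>

lemma zip_shift_walk:
  fixes G :: "'a pair_pre_digraph"
  shows "pre_digraph.cas (with_proj G) u (zip (u # us) (us @ [w])) w \<and>
         pre_digraph.awalk_verts (with_proj G) u (zip (u # us) (us @ [w])) = u # us @ [w]"
proof (induction us arbitrary: u)
  case Nil
  then show ?case
    by (simp add: pre_digraph.cas.simps pre_digraph.awalk_verts.simps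
        del: cas_with_proj_eq awalk_verts_with_proj_eq)
next
  case (Cons a us)
  then show ?case
    by (simp add: pre_digraph.cas.simps pre_digraph.awalk_verts.simps
        del: cas_with_proj_eq awalk_verts_with_proj_eq)
qed

lemma set_zip_shift:
  assumes "successively R (u # us)" and "R (last (u # us)) w"
  shows "\<forall>(a, b) \<in> set (zip (u # us) (us @ [w])). R a b"
  using assms by (induction us arbitrary: u) auto

lemma cycle_of_cyclic_list:
  assumes cyc: "cyclic_list (adj k) vs" and "distinct vs" and v: "v \<in> set vs"
  shows "on_cycle k (length vs) v"
proof -
  obtain u us where vs: "vs = u # us"
    using cyc by (cases vs) (auto simp: cyclic_list_def)
  define p where "p = zip (u # us) (us @ [u])"
  have arcs: "set p \<subseteq> parcs (G_graph k)"
    using set_zip_shift[of "adj k" u us u] cyc unfolding p_def vs cyclic_list_def by auto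
  have pne: "p \<noteq> []" unfolding p_def by (cases us) auto
  have fst_p: "map fst p = u # us" unfolding p_def by simp
  then have "u \<in> fst ` set p" by (metis list.set_intros(1) set_map)
  then have "u \<in> G_verts k" using arcs by (auto simp: G_graph_def)
  then have "pre_digraph.awalk (with_proj (G_graph k)) u p u"
    using zip_shift_walk[of "G_graph k" u us u] arcs
    unfolding pre_digraph.awalk_def p_def by (simp add: G_graph_def)
  moreover have "pre_digraph.awalk_verts (with_proj (G_graph k)) u p = u # us @ [u]"
    using zip_shift_walk[of "G_graph k" u us u] unfolding p_def by blast
  ultimately have "pre_digraph.cycle (with_proj (G_graph k)) p"
    unfolding pre_digraph.cycle_def using pne \<open>distinct vs\<close> vs by (intro exI[of _ u]) simp
  moreover have "length p = length vs" unfolding p_def vs by simp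
  moreover have "v \<in> fst ` set p" using v vs fst_p by (metis set_map)
  ultimately show ?thesis by auto
qed

section \<open>Threading a cycle through internal triangles\<close>

text \<open>
  The pass \<open>(x, i, j, r)\<close> is a visit to the triangle of the cell \<open>(x, r)\<close> that enters it in layer \<open>i\<close>
  and leaves it in layer \<open>j\<close>.
\<close>

type_synonym pass = "Q \<times> nat \<times> nat \<times> nat"

fun cell :: "pass \<Rightarrow> Q \<times> nat" where
  "cell (x, i, j, r) = (x, r)"

fun pass_ok :: "nat \<Rightarrow> pass \<Rightarrow> bool" where
  "pass_ok k (x, i, j, r) \<longleftrightarrow> i \<in> {0,1,2} \<and> j \<in> {0,1,2} \<and> i \<noteq> j \<and> r \<in> {1..k}"

fun joins :: "pass \<Rightarrow> pass \<Rightarrow> bool" where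
  "joins (x, i, j, r) (y, i', j', s) \<longleftrightarrow> i' = j \<and> x \<noteq> y \<and> x + y \<in> P_class j"

text \<open>
  The number \<open>n\<close> is that of the detours still to be made, one in each of the next \<open>n\<close> passes. As the
  layers are \<open>0\<close>, \<open>1\<close> and \<open>2\<close>, the one different from \<open>i\<close> and \<open>j\<close> is \<open>3 - i - j\<close>.
\<close>

fun thread :: "nat \<Rightarrow> pass list \<Rightarrow> vertex list" where
  "thread n [] = []"
| "thread n ((x, i, j, r) # ps) =
     (x, i, r) # (if n = 0 then [] else [(x, 3 - i - j, r)]) @ (x, j, r) # thread (n - 1) ps"

lemma length_thread: "length (thread n ps) = 2 * length ps + min n (length ps)"
  by (induction n ps rule: thread.induct) auto

lemma thread_eq_Nil_iff [simp]: "thread n ps = [] \<longleftrightarrow> ps = []"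
  by (cases "(n, ps)" rule: thread.cases) auto

lemma hd_thread: "hd (thread n ((x, i, j, r) # ps)) = (x, i, r)"
  by simp

lemma last_thread: "ps \<noteq> [] \<Longrightarrow> last ps = (x, i, j, r) \<Longrightarrow> last (thread n ps) = (x, j, r)"
  by (induction n ps rule: thread.induct) (auto split: if_splits)

lemma successively_thread:
  assumes "successively joins ps" and "\<forall>p \<in> set ps. pass_ok k p"
  shows "successively (adj k) (thread n ps)"
  using assms
proof (induction n ps rule: thread.induct)
  case (2 n x i j r ps)
  have IH: "successively (adj k) (thread (n - 1) ps)"
    using 2 by (auto simp: successively_Cons)
  have "ps = [] \<or> adj k (x, j, r) (hd (thread (n - 1) ps))"
  proof (cases ps)
    case (Cons p ps')
    obtain y i' j' s where "p = (y, i', j', s)" by (cases p)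
    then show ?thesis using 2 Cons by (auto simp: adj_iff)
  qed simp
  then show ?case using IH 2(3)
    by (auto simp: successively_Cons adj_iff)
qed simp

lemma thread_in_cells:
  "(x, l, r) \<in> set (thread n ps) \<Longrightarrow> (x, r) \<in> cell ` set ps"
  by (induction n ps rule: thread.induct) (auto split: if_splits)

lemma distinct_thread:
  assumes "distinct (map cell ps)" and "\<forall>p \<in> set ps. pass_ok k p"
  shows "distinct (thread n ps)"
  using assms
proof (induction n ps rule: thread.induct)
  case (2 n x i j r ps)
  have "(x, l, r) \<notin> set (thread (n - 1) ps)" for l
    using thread_in_cells 2(2) by fastforce
  then show ?case using 2 by auto
qed simp

lemma thread_hits:
  "(x, i, j, r) \<in> set ps \<Longrightarrow> l \<in> {i, j} \<Longrightarrow> (x, l, r) \<in> set (thread n ps)"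
  by (induction n ps rule: thread.induct) auto

text \<open>
  The entry and exit vertices of the passes lie on the cycle whatever the number of detours, hence
  one sequence of cells serves its vertices for a whole interval of lengths.
\<close>

lemma cycle_thread:
  assumes cyc: "cyclic_list joins ps" and dist: "distinct (map cell ps)"
    and ok: "\<forall>p \<in> set ps. pass_ok k p"
    and hit: "(x, i, j, r) \<in> set ps" "l \<in> {i, j}"
    and m: "2 * length ps \<le> m" "m \<le> 3 * length ps"
  shows "on_cycle k m (x, l, r)"
proof -
  let ?vs = "thread (m - 2 * length ps) ps"
  obtain y a b s ps' where ps: "ps = (y, a, b, s) # ps'"
    using cyc by (cases ps) (auto simp: cyclic_list_def)
  obtain z c d t where z: "last ps = (z, c, d, t)" by (cases "last ps")
  have "last ps \<in> set ps" using ps by simp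
  then have "adj k (z, d, t) (y, a, s)"
    using cyc ok unfolding cyclic_list_def z by (auto simp: ps adj_iff)
  then have "cyclic_list (adj k) ?vs"
    using last_thread[OF _ z] successively_thread[OF _ ok] cyc ps
    by (simp add: cyclic_list_def del: thread.simps) (simp add: hd_thread ps)
  moreover have "length ?vs = m" using m by (simp add: length_thread)
  ultimately show ?thesis
    using cycle_of_cyclic_list distinct_thread[OF dist ok] thread_hits[OF hit] by metis
qed

section \<open>Concatenating closed sequences of cells\<close>

type_synonym word = "(Q \<times> nat \<times> nat) list"

text \<open>
  A word describes the passes through the cells of a single copy, up to the choice of this copy and
  a translation of \<open>Q\<close>. The conditions on its ends make concatenation possible: it is entered at \<open>000\<close>
  and left at \<open>010\<close>, both times in layer \<open>0\<close>, and \<open>010\<close> belongs to \<open>P\<^sub>0\<close>. So every such word can follow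
  every other one, and also itself. By the last condition, every layer has an entry or exit vertex,
  which lies on the lifted cycle even when there are no detours.
\<close>

definition splicing_word :: "word \<Rightarrow> bool" where
  "splicing_word w \<longleftrightarrow>
     w \<noteq> [] \<and> fst (hd w) = (0,0,0) \<and> fst (snd (hd w)) = 0 \<and>
     fst (last w) = (0,1,0) \<and> snd (snd (last w)) = 0 \<and>
     successively (\<lambda>(x, i, j) (y, i', j'). i' = j \<and> x \<noteq> y \<and> x + y \<in> P_class j) w \<and>
     (\<forall>(x, i, j) \<in> set w. i \<in> {0,1,2} \<and> j \<in> {0,1,2} \<and> i \<noteq> j) \<and>
     distinct (map fst w) \<and>
     (\<forall>l \<in> {0,1,2}. \<exists>(x, i, j) \<in> set w. l \<in> {i, j})"

text \<open>
  The word of length \<open>8\<close> visits all points of \<open>Q\<close>. The lengths \<open>3\<close>, \<open>5\<close> and \<open>8\<close> suffice because the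
  intervals from \<open>2 t\<close> to \<open>3 t\<close> then leave no gap between \<open>6\<close> and \<open>24\<close>.
\<close>

definition word3 :: word where
  "word3 = [((0,0,0), 0, 2), ((0,1,1), 2, 1), ((0,1,0), 1, 0)]"

definition word5 :: word where
  "word5 = [((0,0,0), 0, 2), ((0,1,1), 2, 1), ((1,0,1), 1, 0), ((1,1,1), 0, 1), ((0,1,0), 1, 0)]"

definition word8 :: word where
  "word8 = [((0,0,0), 0, 2), ((0,1,1), 2, 1), ((1,0,1), 1, 0), ((1,1,1), 0, 1),
            ((1,1,0), 1, 0), ((1,0,0), 0, 1), ((0,0,1), 1, 2), ((0,1,0), 2, 0)]"

lemma splicing_words: "splicing_word word3" "splicing_word word5" "splicing_word word8"
  by (simp_all add: splicing_word_def word3_def word5_def word8_def P_class_def)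

definition place :: "Q \<Rightarrow> nat \<Rightarrow> word \<Rightarrow> pass list" where
  "place q r w = map (\<lambda>(x, i, j). (q + x, i, j, r)) w"

lemma Q_add_self: "(q :: Q) + q = 0"
proof -
  have "b + b = 0" for b :: bit by (cases b) auto
  then show ?thesis by (cases q) (simp add: zero_prod_def)
qed

lemma Q_translate_sum: "(q + x) + (q + y) = x + (y :: Q)"
proof -
  have "(q + x) + (q + y) = (q + q) + (x + y)" by (simp add: ac_simps)
  then show ?thesis by (simp add: Q_add_self)
qed

lemma place_props:
  assumes "splicing_word w"
  shows "place q r w \<noteq> []"
    and "successively joins (place q r w)"
    and "distinct (map cell (place q r w))"
    and "r \<in> {1..k} \<Longrightarrow> p \<in> set (place q r w) \<Longrightarrow> pass_ok k p"
    and "p \<in> set (place q r w) \<Longrightarrow> snd (cell p) = r"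
proof -
  show "place q r w \<noteq> []" using assms by (simp add: place_def splicing_word_def)
  have "successively (\<lambda>(x, i, j) (y, i', j'). i' = j \<and> x \<noteq> y \<and> x + y \<in> P_class j) w"
    using assms by (simp add: splicing_word_def)
  then show "successively joins (place q r w)"
    unfolding place_def successively_map
    by (rule successively_mono) (auto simp: Q_translate_sum)
  have "map cell (place q r w) = map (\<lambda>x. (q + x, r)) (map fst w)"
    by (auto simp: place_def)
  moreover have "distinct (map fst w)" using assms by (simp add: splicing_word_def)
  ultimately show "distinct (map cell (place q r w))"
    by (simp only: distinct_map) (auto simp: inj_on_def)
qed (use assms in \<open>auto simp: place_def splicing_word_def\<close>)

text \<open>
  Adjacency ignores copies, so the splice works between different copies as well as, for \<open>r = s\<close>
  and \<open>w = w'\<close>, as the closing edge of a single word.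
\<close>

lemma joins_place:
  assumes "splicing_word w" and "splicing_word w'"
  shows "joins (last (place q r w)) (hd (place q s w'))"
proof -
  obtain i where l: "last w = ((0,1,0), i, 0)"
    using assms(1) by (cases "last w") (auto simp: splicing_word_def)
  obtain j where h: "hd w' = ((0,0,0), 0, j)"
    using assms(2) by (cases "hd w'") (auto simp: splicing_word_def)
  have "w \<noteq> []" "w' \<noteq> []" using assms by (auto simp: splicing_word_def)
  then show ?thesis
    by (simp add: place_def last_map hd_map l h Q_translate_sum) (simp add: P_class_def)
qed

definition tour :: "Q \<Rightarrow> word \<Rightarrow> nat \<Rightarrow> nat list \<Rightarrow> pass list" where
  "tour q w r rs = place q r w @ concat (map (\<lambda>s. place q s word8) rs)"

lemma tour_Nil: "tour q w r [] = place q r w"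
  by (simp add: tour_def)

lemma tour_Cons: "tour q w r (s # rs) = place q r w @ tour q word8 s rs"
  by (simp add: tour_def)

lemma set_tour: "set (tour q w r rs) = set (place q r w) \<union> (\<Union>s \<in> set rs. set (place q s word8))"
  by (simp add: tour_def)

lemma length_tour: "length (tour q w r rs) = length w + 8 * length rs"
  by (induction rs arbitrary: w r) (simp_all add: tour_Nil tour_Cons place_def word8_def)

text \<open>
  Besides being a path, a tour starts as its first word and ends as some splicing word: these are
  the facts that another splice, in front of it or closing it up, asks for.
\<close>

lemma tour_props:
  assumes "splicing_word w"
  shows "tour q w r rs \<noteq> [] \<and> successively joins (tour q w r rs) \<and>
         hd (tour q w r rs) = hd (place q r w) \<and>
         (\<exists>w' s. splicing_word w' \<and> last (tour q w r rs) = last (place q s w'))"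
  using assms
proof (induction rs arbitrary: w r)
  case Nil
  then show ?case using place_props by (auto simp: tour_Nil)
next
  case (Cons s rs)
  show ?case
    using Cons.IH[OF splicing_words(3), of s] place_props(1,2)[OF Cons.prems, where q = q and r = r]
      joins_place[OF Cons.prems splicing_words(3), where q = q and r = r and s = s]
    by (auto simp: tour_Cons successively_append_iff)
qed

lemma cyclic_tour:
  assumes "splicing_word w"
  shows "cyclic_list joins (tour q w r rs)"
  using tour_props[OF assms, of q r rs] joins_place[OF _ assms]
  unfolding cyclic_list_def by metis

lemma tour_copies:
  assumes "splicing_word w"
  shows "p \<in> set (tour q w r rs) \<Longrightarrow> snd (cell p) \<in> set (r # rs)"
  by (auto simp: set_tour dest: place_props(5)[OF assms] place_props(5)[OF splicing_words(3)])

lemma distinct_tour: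
  assumes "splicing_word w" and "distinct (r # rs)"
  shows "distinct (map cell (tour q w r rs))"
  using assms
proof (induction rs arbitrary: w r)
  case Nil
  then show ?case using place_props(3) by (simp add: tour_Nil)
next
  case (Cons s rs)
  have "cell ` set (place q r w) \<inter> cell ` set (tour q word8 s rs) = {}"
  proof -
    have "snd c = r" if "c \<in> cell ` set (place q r w)" for c
      using that place_props(5)[OF Cons.prems(1)] by blast
    moreover have "snd c \<in> set (s # rs)" if "c \<in> cell ` set (tour q word8 s rs)" for c
      using that tour_copies[OF splicing_words(3)] by blast
    ultimately show ?thesis using Cons.prems(2) by (metis disjoint_iff distinct.simps(2))
  qed
  then show ?case
    using Cons.IH[OF splicing_words(3)] Cons.prems place_props(3)
    by (simp add: tour_Cons)
qed

lemma tour_ok: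
  assumes "splicing_word w" and "set (r # rs) \<subseteq> {1..k}"
  shows "\<forall>p \<in> set (tour q w r rs). pass_ok k p"
proof
  fix p assume "p \<in> set (tour q w r rs)"
  then consider "p \<in> set (place q r w)" | s where "s \<in> set rs" "p \<in> set (place q s word8)"
    unfolding set_tour by blast
  then show "pass_ok k p"
  proof cases
    case 1
    then show ?thesis using assms(2) by (intro place_props(4)[OF assms(1)]) auto
  next
    case 2
    then show ?thesis using assms(2) by (intro place_props(4)[OF splicing_words(3)]) auto
  qed
qed

lemma distinct_copies:
  assumes "r \<in> {1..k}" and "j < k"
  obtains rs where "distinct (r # rs)" "set (r # rs) \<subseteq> {1..k}" "length rs = j"
proof -
  have "j \<le> card ({1..k} - {r})" using assms by simp
  then obtain S where S: "S \<subseteq> {1..k} - {r}" "card S = j" "finite S"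
    by (meson obtain_subset_with_card_n)
  obtain rs where rs: "set rs = S" "distinct rs" using finite_distinct_list[OF S(3)] by blast
  show ?thesis
  proof (rule that)
    show "distinct (r # rs)" "set (r # rs) \<subseteq> {1..k}" "length rs = j"
      using S assms(1) rs by (auto simp: distinct_card)
  qed
qed

text \<open>
  Write \<open>m = 24 j + m'\<close> with \<open>1 \<le> m' \<le> 24\<close>, let \<open>j\<close> further copies be traversed by the word of length
  \<open>8\<close>, and choose as first word the shortest one with \<open>m'\<close> at most three times its length. The upper
  bound is then immediate. For \<open>m' \<ge> 6\<close> the lower bound holds with a slack of at least \<open>8 j\<close>. For
  \<open>m' < 6\<close> this slack makes up for the difference, because \<open>6 \<le> m\<close> forces \<open>j > 0\<close>.
\<close>

lemma word_and_copies:
  assumes "6 \<le> m" and "m \<le> 24 * k"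
  obtains w j where "splicing_word w" "j < k"
    "2 * (length w + 8 * j) \<le> m" "m \<le> 3 * (length w + 8 * j)"
proof -
  define j m' where "j = (m - 1) div 24" and "m' = m - 24 * j"
  have jm: "m = 24 * j + m'" "1 \<le> m'" "m' \<le> 24" "j < k"
    using assms unfolding j_def m'_def by linarith+
  have len: "length word3 = 3" "length word5 = 5" "length word8 = 8"
    by (simp_all add: word3_def word5_def word8_def)
  consider "m' \<le> 9" | "9 < m'" "m' \<le> 15" | "15 < m'" by linarith
  then show ?thesis
  proof cases
    case 1
    then have "2 * (3 + 8 * j) \<le> m" "m \<le> 3 * (3 + 8 * j)"
      using assms(1) jm(1,2) by presburger+
    then show ?thesis using that[OF splicing_words(1) jm(4)] unfolding len by blast
  next
    case 2
    then have "2 * (5 + 8 * j) \<le> m" "m \<le> 3 * (5 + 8 * j)"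
      using jm(1) by presburger+
    then show ?thesis using that[OF splicing_words(2) jm(4)] unfolding len by blast
  next
    case 3
    then have "2 * (8 + 8 * j) \<le> m" "m \<le> 3 * (8 + 8 * j)"
      using jm(1,3) by presburger+
    then show ?thesis using that[OF splicing_words(3) jm(4)] unfolding len by blast
  qed
qed

lemma long_cycles:
  assumes v: "l \<in> {0,1,2}" "r \<in> {1..k}" and m: "6 \<le> m" "m \<le> 24 * k"
  shows "on_cycle k m (x, l, r)"
proof -
  obtain w j where w: "splicing_word w" and j: "j < k"
    and len: "2 * (length w + 8 * j) \<le> m" "m \<le> 3 * (length w + 8 * j)"
    using word_and_copies[OF m] .
  obtain rs where rs: "distinct (r # rs)" "set (r # rs) \<subseteq> {1..k}" "length rs = j"
    using distinct_copies[OF v(2) j] .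
  obtain y a b where y: "(y, a, b) \<in> set w" "l \<in> {a, b}"
    using w v(1) unfolding splicing_word_def by fastforce
  \<comment> \<open>The translation that moves the pass using layer \<open>l\<close> to the point \<open>x\<close>.\<close>
  define q where "q = x + y"
  have "q + y = x" unfolding q_def by (simp add: add.assoc Q_add_self)
  then have "(x, a, b, r) \<in> set (tour q w r rs)"
    using y(1) by (force simp: tour_def place_def)
  then show ?thesis
    using cycle_thread[OF cyclic_tour[OF w] distinct_tour[OF w rs(1)] tour_ok[OF w rs(2)]
        _ y(2)] len rs(3) by (simp add: length_tour)
qed

section \<open>Short cycles\<close>

lemma Q_cancel: "x + (x + d) = (d :: Q)"  "(x + d) + x = (d :: Q)"
  using Q_translate_sum[of x 0 d] Q_translate_sum[of x d 0] by simp_all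

lemma Q_add_cancel_right: "(x + d) + d = (x :: Q)"
  by (simp add: add.assoc Q_add_self)

text \<open>
  The lengths are those of an internal triangle, of a quadrangle inside one layer, and of pentagons
  that cross between two layers. The pentagons come from relations between the classes:
  \<open>110 = 100 + 010\<close> makes two steps in layer \<open>0\<close> equal to one in layer \<open>1\<close>, and \<open>100 = 011 + 111\<close> makes
  two steps in layer \<open>2\<close> equal to one in layer \<open>0\<close>.
\<close>

lemma short_cycles:
  assumes l: "l \<in> {0,1,2}" and r: "r \<in> {1..k}" and m: "m \<in> {3,4,5}"
  shows "on_cycle k m (x, l, r)"
proof -
  let ?C = "\<lambda>vs. cyclic_list (adj k) vs \<and> distinct vs \<and> length vs = m \<and> (x, l, r) \<in> set vs"
  note simps = cyclic_list_def adj_iff Q_cancel Q_translate_sum P_class_def zero_prod_def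
  have "\<exists>vs. ?C vs"
  proof -
    consider "m = 3" | "m = 4" | "m = 5" "l \<noteq> 2" | "m = 5" "l = 2" using m by blast
    then show ?thesis
    proof cases
      case 1
      have "?C [(x,0,r), (x,1,r), (x,2,r)]" using l r 1 by (auto simp: simps)
      then show ?thesis by blast
    next
      case 2
      have sq: "?C [(x,l,r), (x + d,l,r), (x + (d + e),l,r), (x + e,l,r)]"
        if de: "d \<in> P_class l" "e \<in> P_class l" "d \<noteq> e" for d e
      proof -
        have 0: "d \<noteq> 0" "e \<noteq> 0" using de l by (auto simp: P_class_def zero_prod_def)
        have "d + e \<noteq> 0" using \<open>d \<noteq> e\<close> by (metis Q_add_cancel_right add_0)
        then show ?thesis using 0 de l r 2
          by (auto simp: cyclic_list_def adj_iff Q_cancel Q_add_cancel_right Q_translate_sum)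
      qed
      have "\<exists>d \<in> P_class l. \<exists>e \<in> P_class l. d \<noteq> e"
        using l by (auto simp: P_class_def)
      then show ?thesis using sq by blast
    next
      case 3
      have "?C [(x,1,r), (x,0,r), (x + (1,0,0),0,r), (x + (1,1,0),0,r), (x + (1,1,0),1,r)]"
        using l r 3 by (auto simp: simps)
      then show ?thesis by blast
    next
      case 4
      have "?C [(x,0,r), (x,2,r), (x + (0,1,1),2,r), (x + (1,0,0),2,r), (x + (1,0,0),0,r)]"
        using l r 4 by (auto simp: simps)
      then show ?thesis by blast
    qed
  qed
  then show ?thesis using cycle_of_cyclic_list by metis
qed

theorem proposition2:
  fixes k :: nat
  assumes "0 < k"
  shows "vertex_pancyclic (with_proj (G_graph k))"
proof -
  interpret pair_graph "G_graph k" by (rule pair_graph_G_graph)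
  have verts: "verts (with_proj (G_graph k)) = G_verts k" by (simp add: G_graph_def)
  have "on_cycle k m v"
    if v: "v \<in> G_verts k" and m: "m \<in> {3..24 * k}" for v m
  proof -
    obtain x l r where "v = (x, l, r)" "l \<in> {0,1,2}" "r \<in> {1..k}"
      using v by (auto simp: G_verts_def)
    moreover have "m \<in> {3,4,5} \<or> 6 \<le> m" using m by auto
    ultimately show ?thesis using short_cycles long_cycles m by (metis atLeastAtMost_iff)
  qed
  then show ?thesis
    unfolding vertex_pancyclic_def verts card_G_verts using assms graph_axioms by auto
qed

end
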